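(* Suppose that for each $l=1,\dots,M+Q$ the induced subgraph $\mathcal{G}^{[l]}$ is undirected and connected. Consider the problem $$(\mathrm{P})\quad \min_{x_1,\dots,x_N}\ \sum_{i=1}^N f_i(x_i)\quad\text{s.t.}\quad \sum_{i=1}^N (A_i x_i+b_i)\le 0,\qquad \sum_{i=1}^N (E_i x_i+g_i)=0,$$ and the problem $$(\mathrm{P}')\quad \min_{x,y}\ \sum_{i=1}^N f_i(x_i)\quad\text{s.t.}\quad \mathbf{A}^{[m]}x^{[m]}+(I-P^{[m]})y^{[m]}+b^{[m]}\le 0,\ m=1,\dots,M,$$ $$\mathbf{E}^{[q]}x^{[M+q]}+(I-P^{[M+q]})y^{[M+q]}+g^{[q]}=0,\ q=1,\dots,Q.$$ Then $(\mathrm{P})$ and $(\mathrm{P}')$ are equivalent in the sense that: (i) they share the same objective function; (ii) for any feasible solution $(x,y)$ of $(\mathrm{P}')$, $x$ is a feasible solution of $(\mathrm{P})$; (iii) for any feasible solution $x$ of $(\mathrm{P})$, there exists some $y$ such that $(x,y)$ is feasible for $(\mathrm{P}')$.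
   Context: Agents are indexed by $\mathcal{V}=\{1,\dots,N\}$. For each agent $i$: $x_i\in\mathbb{R}^{d_i}$, $f_i:\mathbb{R}^{d_i}\to\mathbb{R}$, $A_i\in\mathbb{R}^{M\times d_i}$, $b_i\in\mathbb{R}^M$, $E_i\in\mathbb{R}^{Q\times d_i}$, $g_i\in\mathbb{R}^Q$. Vector inequalities are componentwise. $A_i^{[m]}$ is the $m$-th row of $A_i$, $b_i^{[m]}$ the $m$-th entry of $b_i$; $E_i^{[q]}$, $g_i^{[q]}$ similarly. Affected agents: $\mathcal{V}^{[m]}=\{j: A_j^{[m]}\ne 0 \text{ or } b_j^{[m]}\neq 0\}$ for $m=1,\dots,M$, and $\mathcal{V}^{[M+q]}=\{j: E_j^{[q]}\ne0\text{ or }g_j^{[q]}\ne0\}$ for $q=1,\dots,Q$. Communication: $\mathcal{G}=(\mathcal{V},\mathcal{S})$ is an undirected graph; $\mathcal{G}^{[l]}=(\mathcal{V}^{[l]},\mathcal{S}^{[l]})$ is the subgraph of $\mathcal{G}$ induced by $\mathcal{V}^{[l]}$, $l=1,\dots,M+Q$; $\mathcal{N}_i^{[l]}$ is the set of neighbors of $i$ in $\mathcal{G}^{[l]}$, including $i$ itself. For each $l$, $P^{[l]}=[p_{ij}^{[l]}]$ is a symmetric nonnegative matrix with rows and columns indexed by $\mathcal{V}^{[l]}$, with $p_{ij}^{[l]}>0$ if $j\in\mathcal{N}_i^{[l]}$, $p_{ij}^{[l]}=0$ otherwise, and $\sum_j p_{ij}^{[l]}=1$ for all $i$. Stacked notation: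 $\mathrm{col}$ stacks column vectors and $\mathrm{blkdiag}$ forms block diagonal matrices. $\mathbf{A}^{[m]}=\mathrm{blkdiag}(\{A_i^{[m]}\}_{i\in\mathcal{V}^{[m]}})$, $b^{[m]}=\mathrm{col}(\{b_i^{[m]}\}_{i\in\mathcal{V}^{[m]}})$, $\mathbf{E}^{[q]}=\mathrm{blkdiag}(\{E_i^{[q]}\}_{i\in\mathcal{V}^{[M+q]}})$, $g^{[q]}=\mathrm{col}(\{g_i^{[q]}\}_{i\in\mathcal{V}^{[M+q]}})$, $x^{[l]}=\mathrm{col}(\{x_i\}_{i\in\mathcal{V}^{[l]}})$, $x=\mathrm{col}(x_1,\dots,x_N)$. The auxiliary variables are $y^{[l]}=\mathrm{col}(\{y_i^{[l]}\}_{i\in\mathcal{V}^{[l]}})\in\mathbb{R}^{|\mathcal{V}^{[l]}|}$ (one scalar per affected agent and constraint) and $y=\mathrm{col}(y^{[1]},\dots,y^{[M+Q]})$. *)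

theory Defs
  imports "Jordan_Normal_Form.Matrix" "Graph_Theory.Graph_Theory"
begin

text \<open>
  Agents are \<open>{1..N}\<close>. The \<open>M\<close> inequality constraints and the \<open>Q\<close> equality constraints are
  numbered from 0, as are the rows of a matrix: the indices \<open>l < M\<close> are the rows of the \<open>A i\<close>, and
  \<open>M + q\<close> with \<open>q < Q\<close> is row \<open>q\<close> of the \<open>E i\<close>.
  A stacked decision variable \<open>x = col(x\<^sub>1,\<dots>,x\<^sub>N)\<close> is the family of its blocks, with
  \<open>x i \<in> carrier_vec (d i)\<close>; likewise \<open>y\<close> is the family of its blocks \<open>y l\<close>.
\<close>

record 'z minimization_problem =
  feasible_set :: "'z set"
  objective :: "'z \<Rightarrow> real"


subsection \<open>Affected agents and communication\<close>

definition agents_of_row ::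
  "nat \<Rightarrow> (nat \<Rightarrow> real mat) \<Rightarrow> (nat \<Rightarrow> real vec) \<Rightarrow> nat \<Rightarrow> nat set" where
  "agents_of_row N K c r =
     {j \<in> {1..N}. row (K j) r \<noteq> 0\<^sub>v (dim_col (K j)) \<or> c j $ r \<noteq> 0}"

definition affected_agents ::
  "nat \<Rightarrow> nat \<Rightarrow> (nat \<Rightarrow> real mat) \<Rightarrow> (nat \<Rightarrow> real vec) \<Rightarrow> (nat \<Rightarrow> real mat) \<Rightarrow> (nat \<Rightarrow> real vec)
    \<Rightarrow> nat \<Rightarrow> nat set" where
  "affected_agents N M A b E g l =
     (if l < M then agents_of_row N A b l else agents_of_row N E g (l - M))"

definition induced_comm_graph ::
  "nat pair_pre_digraph \<Rightarrow> nat \<Rightarrow> nat \<Rightarrow> (nat \<Rightarrow> real mat) \<Rightarrow> (nat \<Rightarrow> real vec)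
    \<Rightarrow> (nat \<Rightarrow> real mat) \<Rightarrow> (nat \<Rightarrow> real vec) \<Rightarrow> nat \<Rightarrow> (nat, nat \<times> nat) pre_digraph" where
  "induced_comm_graph G N M A b E g l = with_proj G \<restriction> affected_agents N M A b E g l"

definition closed_neighbours :: "('a, 'e) pre_digraph \<Rightarrow> 'a \<Rightarrow> 'a set" where
  "closed_neighbours H i = {j \<in> verts H. j = i \<or> i \<rightarrow>\<^bsub>H\<^esub> j}"

definition consensus_weights :: "('a, 'e) pre_digraph \<Rightarrow> ('a \<Rightarrow> 'a \<Rightarrow> real) \<Rightarrow> bool" where
  "consensus_weights H p \<longleftrightarrow>
     (\<forall>i \<in> verts H. \<forall>j \<in> verts H. p i j = p j i \<and> 0 \<le> p i j) \<and>
     (\<forall>i \<in> verts H. \<forall>j \<in> verts H.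
        (j \<in> closed_neighbours H i \<longrightarrow> 0 < p i j) \<and> (j \<notin> closed_neighbours H i \<longrightarrow> p i j = 0)) \<and>
     (\<forall>i \<in> verts H. (\<Sum>j \<in> verts H. p i j) = 1)"


subsection \<open>Stacking over a finite set of agents\<close>

text \<open>All three operations enumerate the agents in increasing order.\<close>

definition col_over :: "nat set \<Rightarrow> (nat \<Rightarrow> real vec) \<Rightarrow> real vec" where
  "col_over S v = foldr (@\<^sub>v) (map v (sorted_list_of_set S)) vNil"

definition blkdiag_over :: "nat set \<Rightarrow> (nat \<Rightarrow> real mat) \<Rightarrow> real mat" where
  "blkdiag_over S B = diag_block_mat (map B (sorted_list_of_set S))"

definition mat_over :: "nat set \<Rightarrow> (nat \<Rightarrow> nat \<Rightarrow> real) \<Rightarrow> real mat" where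
  "mat_over S p =
     mat (card S) (card S) (\<lambda>(s, t). p (sorted_list_of_set S ! s) (sorted_list_of_set S ! t))"

text \<open>
  The left-hand side \<open>\<^bold>Kx + (I - P)y + c\<close> of the constraints that replace row \<open>r\<close> of
  \<open>\<Sum>\<^sub>i (K\<^sub>i x\<^sub>i + c\<^sub>i)\<close>; here \<open>S\<close> is the set of agents affected by that row.
\<close>

definition local_constraint_lhs ::
  "nat set \<Rightarrow> (nat \<Rightarrow> real mat) \<Rightarrow> (nat \<Rightarrow> real vec) \<Rightarrow> nat \<Rightarrow> (nat \<Rightarrow> nat \<Rightarrow> real)
    \<Rightarrow> (nat \<Rightarrow> real vec) \<Rightarrow> real vec \<Rightarrow> real vec" where
  "local_constraint_lhs S K c r p x y =
     blkdiag_over S (\<lambda>i. mat_of_row (row (K i) r)) *\<^sub>v col_over S x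
     + (1\<^sub>m (card S) - mat_over S p) *\<^sub>v y
     + col_over S (\<lambda>i. vec 1 (\<lambda>_. c i $ r))"


subsection \<open>The two problems\<close>

text \<open>The order on vectors is componentwise.\<close>

definition coupled_problem ::
  "nat \<Rightarrow> nat \<Rightarrow> nat \<Rightarrow> (nat \<Rightarrow> nat) \<Rightarrow> (nat \<Rightarrow> real vec \<Rightarrow> real)
    \<Rightarrow> (nat \<Rightarrow> real mat) \<Rightarrow> (nat \<Rightarrow> real vec) \<Rightarrow> (nat \<Rightarrow> real mat) \<Rightarrow> (nat \<Rightarrow> real vec)
    \<Rightarrow> (nat \<Rightarrow> real vec) minimization_problem" where
  "coupled_problem N M Q d f A b E g =
     \<lparr> feasible_set = {x.
         (\<forall>i \<in> {1..N}. x i \<in> carrier_vec (d i)) \<and>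
         finsum_vec TYPE(real) M (\<lambda>i. A i *\<^sub>v x i + b i) {1..N} \<le> 0\<^sub>v M \<and>
         finsum_vec TYPE(real) Q (\<lambda>i. E i *\<^sub>v x i + g i) {1..N} = 0\<^sub>v Q},
       objective = (\<lambda>x. \<Sum>i = 1..N. f i (x i)) \<rparr>"

definition decoupled_problem ::
  "nat \<Rightarrow> nat \<Rightarrow> nat \<Rightarrow> (nat \<Rightarrow> nat) \<Rightarrow> (nat \<Rightarrow> real vec \<Rightarrow> real)
    \<Rightarrow> (nat \<Rightarrow> real mat) \<Rightarrow> (nat \<Rightarrow> real vec) \<Rightarrow> (nat \<Rightarrow> real mat) \<Rightarrow> (nat \<Rightarrow> real vec)
    \<Rightarrow> (nat \<Rightarrow> nat \<Rightarrow> nat \<Rightarrow> real)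
    \<Rightarrow> ((nat \<Rightarrow> real vec) \<times> (nat \<Rightarrow> real vec)) minimization_problem" where
  "decoupled_problem N M Q d f A b E g p =
     \<lparr> feasible_set = {(x, y).
         (\<forall>i \<in> {1..N}. x i \<in> carrier_vec (d i)) \<and>
         (\<forall>l < M + Q. y l \<in> carrier_vec (card (affected_agents N M A b E g l))) \<and>
         (\<forall>m < M. let S = affected_agents N M A b E g m in
            local_constraint_lhs S A b m (p m) x (y m) \<le> 0\<^sub>v (card S)) \<and>
         (\<forall>q < Q. let S = affected_agents N M A b E g (M + q) in
            local_constraint_lhs S E g q (p (M + q)) x (y (M + q)) = 0\<^sub>v (card S))},
       objective = (\<lambda>(x, y). \<Sum>i = 1..N. f i (x i)) \<rparr>"

end

theory Submission
  imports Defs "Jordan_Normal_Form.Determinant"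
begin

text \<open>
  Since \<open>P\<close> is symmetric and stochastic, the entries of \<open>(I - P)y\<close> sum to zero, so summing the local
  constraints over the affected agents gives back the row of the coupled constraint.
  Conversely, a maximum principle on the connected graph shows that the kernel of \<open>I - P\<close> consists of the
  constant vectors. Hence \<open>I - P + J\<close>, with \<open>J\<close> the all-ones matrix, is injective and therefore
  surjective, and its solutions for a zero-sum right-hand side have zero sum. So every zero-sum
  vector is \<open>(I - P)y\<close> for some \<open>y\<close>, and \<open>y\<close> can be chosen such that all local constraints of a row equal the
  average of that row.
\<close>

section \<open>Finite linear systems\<close>

lemma bij_betw_nth_sorted_list_of_set:
  assumes "finite S"
  shows "bij_betw ((!) (sorted_list_of_set S)) {..<card S} S"
  using assms by (intro bij_betw_nth) auto

lemma sum_nth_sorted_list_of_set: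
  assumes "finite S"
  shows "(\<Sum>s<card S. h (sorted_list_of_set S ! s)) = sum h S"
  by (rule sum.reindex_bij_betw[OF bij_betw_nth_sorted_list_of_set[OF assms]])

text \<open>Matrices and vectors are indexed by positions, weights and graphs by agents. The
  enumeration of \<open>S\<close> is a bijection, so inverting it turns any vector into a family
  over agents, and sums over \<open>S\<close> can replace sums over positions.\<close>

lemma vec_nth_sorted_list_of_set_cases:
  assumes "finite S" "v \<in> carrier_vec (card S)"
  obtains V where "v = vec (card S) (\<lambda>s. V (sorted_list_of_set S ! s))"
proof
  let ?e = "(!) (sorted_list_of_set S)"
  let ?V = "\<lambda>i. v $ the_inv_into {..<card S} ?e i"
  have "inj_on ?e {..<card S}"
    using bij_betw_nth_sorted_list_of_set[OF assms(1)] by (rule bij_betw_imp_inj_on)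
  then show "v = vec (card S) (\<lambda>s. ?V (?e s))"
    using assms(2) by (intro eq_vecI) (auto simp: the_inv_into_f_f)
qed

lemma mat_over_mult_vec_nth:
  assumes "finite S" "s < card S"
  shows "(mat_over S B *\<^sub>v vec (card S) (\<lambda>s. v (sorted_list_of_set S ! s))) $ s
       = (\<Sum>j\<in>S. B (sorted_list_of_set S ! s) j * v j)"
proof -
  have "(mat_over S B *\<^sub>v vec (card S) (\<lambda>s. v (sorted_list_of_set S ! s))) $ s
      = (\<Sum>t<card S. B (sorted_list_of_set S ! s) (sorted_list_of_set S ! t)
           * v (sorted_list_of_set S ! t))"
    using assms(2) by (simp add: mat_over_def scalar_prod_def lessThan_atLeast0)
  also have "\<dots> = (\<Sum>j\<in>S. B (sorted_list_of_set S ! s) j * v j)"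
    by (rule sum_nth_sorted_list_of_set[OF assms(1)])
  finally show ?thesis .
qed

text \<open>A square matrix with trivial kernel has nonzero determinant and hence an inverse.
  Stating this over \<open>S\<close> keeps the enumeration out of the later arguments.\<close>

lemma finite_linear_system_solvable:
  fixes B :: "nat \<Rightarrow> nat \<Rightarrow> real"
  assumes S: "finite S"
    and inj: "\<And>v. (\<And>i. i \<in> S \<Longrightarrow> (\<Sum>j\<in>S. B i j * v j) = 0) \<Longrightarrow> (\<And>i. i \<in> S \<Longrightarrow> v i = 0)"
  shows "\<exists>y. \<forall>i\<in>S. (\<Sum>j\<in>S. B i j * y j) = z i"
proof -
  let ?n = "card S" and ?e = "(!) (sorted_list_of_set S)" and ?B = "mat_over S B"
  have B: "?B \<in> carrier_mat ?n ?n"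
    by (simp add: mat_over_def)
  have onto: "\<exists>s<?n. i = ?e s" if "i \<in> S" for i
    using bij_betw_nth_sorted_list_of_set[OF S] that by (auto simp: bij_betw_def)
  have mem: "?e s \<in> S" if "s < ?n" for s
    using bij_betw_nth_sorted_list_of_set[OF S] that by (auto simp: bij_betw_def)
  have "det ?B \<noteq> 0"
  proof
    assume "det ?B = 0"
    then obtain v where v: "v \<in> carrier_vec ?n" "v \<noteq> 0\<^sub>v ?n" "?B *\<^sub>v v = 0\<^sub>v ?n"
      using det_0_iff_vec_prod_zero_field[OF B] by blast
    obtain V where V: "v = vec ?n (\<lambda>s. V (?e s))"
      using vec_nth_sorted_list_of_set_cases[OF S v(1)] .
    have "(\<Sum>j\<in>S. B i j * V j) = 0" if "i \<in> S" for i
      using onto[OF that] mat_over_mult_vec_nth[OF S, of _ B V] v(3) unfolding V by auto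
    then have "V i = 0" if "i \<in> S" for i
      using inj that by blast
    then have "v = 0\<^sub>v ?n"
      unfolding V by (intro eq_vecI) (auto simp: mem)
    with v(2) show False by simp
  qed
  \<comment> \<open>The \<open>()\<close> only fills the extension field of the matrix ring
    record.\<close>
  from det_non_zero_imp_unit[OF B this, of "()"] obtain C where
    C: "C \<in> carrier_mat ?n ?n" "?B * C = 1\<^sub>m ?n"
    by (auto simp: Units_def ring_mat_def)
  define u where "u = vec ?n (\<lambda>s. z (?e s))"
  have "C *\<^sub>v u \<in> carrier_vec ?n"
    using C by (simp add: u_def)
  then obtain Y where Y: "C *\<^sub>v u = vec ?n (\<lambda>s. Y (?e s))"
    using vec_nth_sorted_list_of_set_cases[OF S] by blast
  have "?B *\<^sub>v (C *\<^sub>v u) = u"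
    using B C by (simp add: assoc_mult_mat_vec[symmetric, of _ ?n ?n _ ?n] u_def)
  then have "(\<Sum>j\<in>S. B (?e s) j * Y j) = z (?e s)" if "s < ?n" for s
    using mat_over_mult_vec_nth[OF S that, of B Y] that unfolding Y by (simp add: u_def)
  then show ?thesis
    using onto by blast
qed


section \<open>The range of \<open>I - P\<close>\<close>

lemma
  assumes "consensus_weights H w" "i \<in> verts H"
  shows consensus_weights_nonneg: "j \<in> verts H \<Longrightarrow> 0 \<le> w i j"
    and consensus_weights_sym: "j \<in> verts H \<Longrightarrow> w i j = w j i"
    and consensus_weights_row_sum: "(\<Sum>j\<in>verts H. w i j) = 1"
  using assms unfolding consensus_weights_def by blast+

text \<open>Connectedness is strong connectedness of the symmetric closure, so the maximum principle
  moves along arcs of that closure. Such an arc comes from an arc of \<open>H\<close> in one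
  direction or the other, and the symmetry of \<open>w\<close> makes the weight positive either
  way.\<close>

lemma consensus_weights_pos_of_adjacent:
  assumes "consensus_weights H w" "u \<rightarrow>\<^bsub>with_proj (mk_symmetric H)\<^esub> v"
    and "u \<in> verts H" "v \<in> verts H"
  shows "0 < w u v"
proof -
  have "u \<rightarrow>\<^bsub>H\<^esub> v \<or> v \<rightarrow>\<^bsub>H\<^esub> u"
    using assms(2) by (auto simp: mk_symmetric_def arcs_ends_def arc_to_ends_def)
  then have "v \<in> closed_neighbours H u \<or> u \<in> closed_neighbours H v"
    using assms(3,4) by (auto simp: closed_neighbours_def)
  then have "0 < w u v \<or> 0 < w v u"
    using assms(1,3,4) unfolding consensus_weights_def by blast
  then show ?thesis
    using consensus_weights_sym[OF assms(1,3,4)] by simp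
qed

text \<open>Maximum principle: at a maximal vertex the weighted average can only equal \<open>v i\<close> if all
  neighbours are maximal too.\<close>

lemma consensus_weights_fixpoint_const:
  fixes H :: "('a, 'e) pre_digraph" and v :: "'a \<Rightarrow> real"
  assumes w: "consensus_weights H w" and fin: "finite (verts H)"
    and conn: "Digraph_Component.connected H"
    and fix_v: "\<And>i. i \<in> verts H \<Longrightarrow> (\<Sum>j\<in>verts H. w i j * v j) = v i"
  obtains c where "\<And>i. i \<in> verts H \<Longrightarrow> v i = c"
proof -
  let ?S = "verts H" and ?H = "with_proj (mk_symmetric H)"
  have verts: "verts ?H = ?S"
    by (simp add: mk_symmetric_def)
  have strong: "?S \<noteq> {}" "\<And>i j. i \<in> ?S \<Longrightarrow> j \<in> ?S \<Longrightarrow> i \<rightarrow>\<^sup>*\<^bsub>?H\<^esub> j"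
    using conn unfolding connected_def strongly_connected_def verts by auto
  have "Max (v ` ?S) \<in> v ` ?S"
    using fin strong(1) by (intro Max_in) auto
  then obtain k where k: "k \<in> ?S" "v k = Max (v ` ?S)"
    by (metis imageE)
  have le: "v j \<le> v k" if "j \<in> ?S" for j
    using fin that k(2) by simp
  have propagate: "v j = v k" if "i \<in> ?S" "j \<in> ?S" "i \<rightarrow>\<^bsub>?H\<^esub> j" "v i = v k" for i j
  proof -
    \<comment> \<open>All gaps \<open>v k - v j\<close> are nonnegative and their weighted sum is
      zero, so each weighted gap vanishes. A positive weight then forces
      \<open>v j = v k\<close>.\<close>
    have "(\<Sum>j\<in>?S. w i j * (v k - v j)) = (\<Sum>j\<in>?S. w i j) * v k - (\<Sum>j\<in>?S. w i j * v j)"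
      by (simp add: right_diff_distrib sum_subtractf sum_distrib_right)
    also have "\<dots> = 0"
      using consensus_weights_row_sum[OF w that(1)] fix_v[OF that(1)] that(4) by simp
    finally have "\<forall>j\<in>?S. w i j * (v k - v j) = 0"
      using fin le consensus_weights_nonneg[OF w that(1)]
      by (subst (asm) sum_nonneg_eq_0_iff) auto
    then have "w i j * (v k - v j) = 0"
      using that(2) by blast
    then show ?thesis
      using consensus_weights_pos_of_adjacent[OF w that(3,1,2)] by simp
  qed
  have "i \<in> ?S \<and> v i = v k" if "k \<rightarrow>\<^sup>*\<^bsub>?H\<^esub> i" for i
    using that unfolding reachable_def
  proof (induction rule: rtrancl_on_induct)
    case (step x y)
    then show ?case
      using propagate[of x y] verts by simp
  qed (use k in simp)
  then show thesis
    using that strong(2)[OF k(1)] by blast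
qed

text \<open>After exchanging the sums, symmetry turns column sums into row sums, which are 1. This
  cancels the auxiliary variables in a summed constraint and also controls the sum of solutions
  below.\<close>

lemma consensus_weights_sum:
  assumes "consensus_weights H w"
  shows "(\<Sum>i\<in>verts H. \<Sum>j\<in>verts H. w i j * v j) = (\<Sum>i\<in>verts H. v i)"
proof -
  have "(\<Sum>i\<in>verts H. \<Sum>j\<in>verts H. w i j * v j) = (\<Sum>j\<in>verts H. (\<Sum>i\<in>verts H. w j i) * v j)"
    unfolding sum_distrib_right
    by (subst sum.swap) (simp add: consensus_weights_sym[OF assms] cong: sum.cong)
  then show ?thesis
    using consensus_weights_row_sum[OF assms] by simp
qed

lemma consensus_weights_range:
  fixes H :: "(nat, 'e) pre_digraph" and z :: "nat \<Rightarrow> real"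
  assumes w: "consensus_weights H w" and fin: "finite (verts H)"
    and conn: "Digraph_Component.connected H"
    and z: "(\<Sum>i\<in>verts H. z i) = 0"
  obtains y where "\<And>i. i \<in> verts H \<Longrightarrow> y i - (\<Sum>j\<in>verts H. w i j * y j) = z i"
proof -
  let ?S = "verts H"
  \<comment> \<open>This is I - P + J: the added 1 in every entry is what removes the constant
    vectors from the kernel.\<close>
  define B where "B i j = (if i = j then 1 else 0) - w i j + 1" for i j
  have B: "(\<Sum>j\<in>?S. B i j * v j) = v i - (\<Sum>j\<in>?S. w i j * v j) + (\<Sum>j\<in>?S. v j)"
    if "i \<in> ?S" for i v
  proof -
    have "(\<Sum>j\<in>?S. B i j * v j) = (\<Sum>j\<in>?S. (if i = j then v j else 0) - w i j * v j + v j)"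
      by (rule sum.cong) (auto simp: B_def algebra_simps)
    then show ?thesis
      using fin that by (simp add: sum.distrib sum_subtractf)
  qed
  \<comment> \<open>Connectedness includes that the graph has a vertex.\<close>
  have card: "card ?S > 0"
    using conn fin by (auto simp: connected_def strongly_connected_def mk_symmetric_def card_gt_0_iff)
  \<comment> \<open>Summing all rows, I - P contributes nothing and J contributes
    \<open>card ?S\<close> times the sum of \<open>v\<close>. This is used with \<open>u = 0\<close>
    for injectivity and with \<open>u = z\<close> for the solution.\<close>
  have sum0: "(\<Sum>j\<in>?S. v j) = 0"
    if "\<And>i. i \<in> ?S \<Longrightarrow> (\<Sum>j\<in>?S. B i j * v j) = u i" "(\<Sum>i\<in>?S. u i) = 0" for v u
  proof -
    have "0 = (\<Sum>i\<in>?S. \<Sum>j\<in>?S. B i j * v j)"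
      using that by simp
    also have "\<dots> = (\<Sum>i\<in>?S. v i - (\<Sum>j\<in>?S. w i j * v j) + (\<Sum>j\<in>?S. v j))"
      using B by simp
    also have "\<dots> = real (card ?S) * (\<Sum>j\<in>?S. v j)"
      by (simp add: sum.distrib sum_subtractf consensus_weights_sum[OF w])
    finally show ?thesis
      using card by simp
  qed
  have "\<exists>y. \<forall>i\<in>?S. (\<Sum>j\<in>?S. B i j * y j) = z i"
  proof (rule finite_linear_system_solvable[OF fin])
    fix v i
    assume ker: "\<And>i. i \<in> ?S \<Longrightarrow> (\<Sum>j\<in>?S. B i j * v j) = 0" and i: "i \<in> ?S"
    have s0: "(\<Sum>j\<in>?S. v j) = 0"
      using sum0[of v "\<lambda>_. 0"] ker by simp
    then have "(\<Sum>j\<in>?S. w i j * v j) = v i" if "i \<in> ?S" for i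
      using B[OF that, of v] ker[OF that] by simp
    then obtain c where c: "\<And>i. i \<in> ?S \<Longrightarrow> v i = c"
      using consensus_weights_fixpoint_const[OF w fin conn] by blast
    \<comment> \<open>A kernel vector of \<open>B\<close> is constant with zero sum, hence
      zero.\<close>
    then have "real (card ?S) * c = 0"
      using s0 by simp
    then show "v i = 0"
      using card c i by simp
  qed
  then obtain y where y: "\<And>i. i \<in> ?S \<Longrightarrow> (\<Sum>j\<in>?S. B i j * y j) = z i"
    by blast
  \<comment> \<open>The solution has zero sum, so the J part of \<open>B\<close> drops out and I - P
    alone maps \<open>y\<close> to \<open>z\<close>.\<close>
  show thesis
    using that[of y] B[of _ y] y sum0[OF y z] by simp
qed


section \<open>Entries of the local constraints\<close>

text \<open>Both the block matrix and the stacked vector are built by recursion on the list, so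
  induction peels off one block at a time. Each block is a single row and therefore yields a single
  entry, whatever its width.\<close>

lemma diag_block_mat_rows_mult_append:
  assumes "\<And>i. i \<in> set is \<Longrightarrow> x i \<in> carrier_vec (dim_vec (w i))"
  shows "diag_block_mat (map (\<lambda>i. mat_of_row (w i)) is) *\<^sub>v foldr (@\<^sub>v) (map x is) vNil
       = vec (length is) (\<lambda>s. w (is ! s) \<bullet> (x (is ! s) :: real vec))"
  using assms
proof (induction "is")
  case (Cons i "is")
  let ?D = "diag_block_mat (map (\<lambda>i. mat_of_row (w i)) is)"
  let ?X = "foldr (@\<^sub>v) (map x is) vNil"
  \<comment> \<open>The block product rule applies only if the stacked tail is cut exactly where the
    first block ends.\<close>
  have "dim_vec ?X = dim_col ?D"
    using Cons.prems[OF list.set_intros(2)] by (induction "is") (auto simp: Let_def)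
  then have X: "?X \<in> carrier_vec (dim_col ?D)"
    by (rule carrier_vecI)
  have xi: "x i \<in> carrier_vec (dim_vec (w i))"
    using Cons.prems by simp
  have "diag_block_mat (map (\<lambda>i. mat_of_row (w i)) (i # is)) *\<^sub>v foldr (@\<^sub>v) (map x (i # is)) vNil
      = four_block_mat (mat_of_row (w i)) (0\<^sub>m 1 (dim_col ?D)) (0\<^sub>m (dim_row ?D) (dim_vec (w i))) ?D
          *\<^sub>v (x i @\<^sub>v ?X)"
    by (simp add: Let_def)
  also have "\<dots> = (mat_of_row (w i) *\<^sub>v x i + 0\<^sub>m 1 (dim_col ?D) *\<^sub>v ?X)
      @\<^sub>v (0\<^sub>m (dim_row ?D) (dim_vec (w i)) *\<^sub>v x i + ?D *\<^sub>v ?X)"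
    using xi X by (intro four_block_mat_mult_vec) auto
  also have "\<dots> = mat_of_row (w i) *\<^sub>v x i @\<^sub>v ?D *\<^sub>v ?X"
    using xi X by (intro arg_cong2[of _ _ _ _ "(@\<^sub>v)"] eq_vecI) auto
  also have "?D *\<^sub>v ?X = vec (length is) (\<lambda>s. w (is ! s) \<bullet> x (is ! s))"
    using Cons by simp
  also have "mat_of_row (w i) *\<^sub>v x i @\<^sub>v \<dots>
      = vec (length (i # is)) (\<lambda>s. w ((i # is) ! s) \<bullet> x ((i # is) ! s))"
    by (intro eq_vecI) (auto simp: nth_Cons' append_vec_def Let_def)
  finally show ?case .
qed (auto intro: eq_vecI)

lemma foldr_append_singletons:
  "foldr (@\<^sub>v) (map (\<lambda>i. vec 1 (\<lambda>_. h i)) is) vNil = vec (length is) (\<lambda>s. h (is ! s))"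
  by (induction "is") (auto intro!: eq_vecI simp: nth_Cons' append_vec_def Let_def)

text \<open>Bridge from the stacked form to one scalar expression per affected agent;
  \<open>y\<close> is given as a family over agents so that the coupling term becomes a sum over
  \<open>S\<close>.\<close>

lemma local_constraint_lhs_eq:
  assumes S: "finite S"
    and x: "\<And>i. i \<in> S \<Longrightarrow> x i \<in> carrier_vec (dim_col (K i))"
  shows "local_constraint_lhs S K c r w x (vec (card S) (\<lambda>s. y (sorted_list_of_set S ! s)))
    = vec (card S) (\<lambda>s. let i = sorted_list_of_set S ! s in
        row (K i) r \<bullet> x i + c i $ r + (y i - (\<Sum>j\<in>S. w i j * y j)))"
proof -
  let ?n = "card S" and ?e = "(!) (sorted_list_of_set S)"
  let ?y = "vec ?n (\<lambda>s. y (?e s))"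
  have "blkdiag_over S (\<lambda>i. mat_of_row (row (K i) r)) *\<^sub>v col_over S x
      = vec ?n (\<lambda>s. row (K (?e s)) r \<bullet> x (?e s))"
    unfolding blkdiag_over_def col_over_def
    using S x by (subst diag_block_mat_rows_mult_append) auto
  moreover have "(1\<^sub>m ?n - mat_over S w) *\<^sub>v ?y = ?y - mat_over S w *\<^sub>v ?y"
    by (subst minus_mult_distrib_mat_vec[of _ ?n ?n]) (auto simp: mat_over_def)
  moreover have "col_over S (\<lambda>i. vec 1 (\<lambda>_. c i $ r)) = vec ?n (\<lambda>s. c (?e s) $ r)"
    unfolding col_over_def foldr_append_singletons using S by simp
  moreover have "dim_vec (mat_over S w *\<^sub>v ?y) = ?n"
    by (simp add: mat_over_def)
  ultimately show ?thesis
    using S unfolding local_constraint_lhs_def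
    \<comment> \<open>Without the deletion, the product with \<open>mat_over\<close> would unfold to
      a scalar product before \<open>mat_over_mult_vec_nth\<close> could apply.\<close>
    by (intro eq_vecI) (simp_all add: mat_over_mult_vec_nth Let_def del: index_mult_mat_vec)
qed

text \<open>A vector sum takes the dimension of its last summand, here the stacked
  constants.\<close>

lemma dim_local_constraint_lhs [simp]:
  "finite S \<Longrightarrow> dim_vec (local_constraint_lhs S K c r w x y) = card S"
  unfolding local_constraint_lhs_def col_over_def foldr_append_singletons by simp

section \<open>Coupled rows compared with local constraints\<close>

lemma finite_agents_of_row [simp]: "finite (agents_of_row N K c r)"
  by (simp add: agents_of_row_def)

text \<open>An agent outside the affected set has a zero row and a zero constant, so dropping it
  leaves the sum unchanged.\<close>

lemma coupled_constraint_row: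
  assumes K: "\<And>i. i \<in> {1..N} \<Longrightarrow> K i \<in> carrier_mat R (d i)"
    and c: "\<And>i. i \<in> {1..N} \<Longrightarrow> c i \<in> carrier_vec R"
    and x: "\<And>i. i \<in> {1..N} \<Longrightarrow> x i \<in> carrier_vec (d i)"
    and r: "r < R"
  shows "finsum_vec TYPE(real) R (\<lambda>i. K i *\<^sub>v x i + c i) {1..N} $ r
       = (\<Sum>i\<in>agents_of_row N K c r. row (K i) r \<bullet> x i + c i $ r)"
proof -
  have "finsum_vec TYPE(real) R (\<lambda>i. K i *\<^sub>v x i + c i) {1..N} $ r
      = (\<Sum>i\<in>{1..N}. (K i *\<^sub>v x i + c i) $ r)"
    using K c x r by (intro index_finsum_vec) (fastforce intro!: add_carrier_vec mult_mat_vec_carrier)+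
  also have "\<dots> = (\<Sum>i\<in>{1..N}. row (K i) r \<bullet> x i + c i $ r)"
  proof (rule sum.cong)
    fix i assume i: "i \<in> {1..N}"
    show "(K i *\<^sub>v x i + c i) $ r = row (K i) r \<bullet> x i + c i $ r"
      using K[OF i] c[OF i] r by auto
  qed simp
  also have "\<dots> = (\<Sum>i\<in>agents_of_row N K c r. row (K i) r \<bullet> x i + c i $ r)"
  proof (rule sum.mono_neutral_right)
    show "\<forall>i\<in>{1..N} - agents_of_row N K c r. row (K i) r \<bullet> x i + c i $ r = 0"
    proof
      fix i assume i: "i \<in> {1..N} - agents_of_row N K c r"
      then have "x i \<in> carrier_vec (dim_col (K i))"
        using K[of i] x[of i] by auto
      then show "row (K i) r \<bullet> x i + c i $ r = 0"
        using i by (simp add: agents_of_row_def)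
    qed
  qed (auto simp: agents_of_row_def)
  finally show ?thesis .
qed

text \<open>The terms in \<open>y\<close> cancel in the sum by \<open>consensus_weights_sum\<close>.
  It carries feasibility from the local constraints to the coupled row; for an empty
  \<open>S\<close> both sides are 0.\<close>

lemma sum_local_constraint_lhs:
  assumes "\<And>i. i \<in> {1..N} \<Longrightarrow> K i \<in> carrier_mat R (d i)"
    and "\<And>i. i \<in> {1..N} \<Longrightarrow> c i \<in> carrier_vec R"
    and "\<And>i. i \<in> {1..N} \<Longrightarrow> x i \<in> carrier_vec (d i)"
    and "r < R"
    and S: "S = agents_of_row N K c r"
    and H: "verts H = S" "consensus_weights H w"
    and y: "y \<in> carrier_vec (card S)"
  shows "(\<Sum>s<card S. local_constraint_lhs S K c r w x y $ s)
       = finsum_vec TYPE(real) R (\<lambda>i. K i *\<^sub>v x i + c i) {1..N} $ r"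
proof -
  have fin: "finite S"
    by (simp add: S)
  have x: "x i \<in> carrier_vec (dim_col (K i))" if "i \<in> S" for i
    using assms(1,3)[of i] that by (auto simp: S agents_of_row_def)
  obtain Y where Y: "y = vec (card S) (\<lambda>s. Y (sorted_list_of_set S ! s))"
    using vec_nth_sorted_list_of_set_cases[OF fin y] .
  have "(\<Sum>s<card S. local_constraint_lhs S K c r w x y $ s)
      = (\<Sum>i\<in>S. row (K i) r \<bullet> x i + c i $ r + (Y i - (\<Sum>j\<in>S. w i j * Y j)))"
    unfolding Y using x sum_nth_sorted_list_of_set[OF fin, of "\<lambda>i. row (K i) r \<bullet> x i + c i $ r
      + (Y i - (\<Sum>j\<in>S. w i j * Y j))"]
    by (simp add: local_constraint_lhs_eq[OF fin] Let_def)
  also have "\<dots> = (\<Sum>i\<in>S. row (K i) r \<bullet> x i + c i $ r)"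
    using consensus_weights_sum[OF H(2), of Y] H(1) by (simp add: sum.distrib sum_subtractf)
  finally show ?thesis
    using coupled_constraint_row[OF assms(1-4)] S by simp
qed

text \<open>Spreading the row total evenly suits both kinds of constraint: the average is
  nonpositive, or zero, whenever the total is. The empty \<open>S\<close> is treated apart because
  an empty graph is not connected.\<close>

lemma equalize_local_constraint_lhs:
  assumes "\<And>i. i \<in> {1..N} \<Longrightarrow> K i \<in> carrier_mat R (d i)"
    and "\<And>i. i \<in> {1..N} \<Longrightarrow> c i \<in> carrier_vec R"
    and "\<And>i. i \<in> {1..N} \<Longrightarrow> x i \<in> carrier_vec (d i)"
    and "r < R"
    and S: "S = agents_of_row N K c r"
    and H: "verts H = S" "consensus_weights H w"
      "S \<noteq> {} \<Longrightarrow> Digraph_Component.connected H"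
  obtains y where "y \<in> carrier_vec (card S)"
    and "local_constraint_lhs S K c r w x y = vec (card S)
      (\<lambda>_. finsum_vec TYPE(real) R (\<lambda>i. K i *\<^sub>v x i + c i) {1..N} $ r / card S)"
proof (cases "S = {}")
  case True
  show thesis
    \<comment> \<open>Both sides have dimension 0, so the quotient by \<open>card S = 0\<close>
      never occurs as an entry.\<close>
    by (rule that[of vNil]) (auto simp: True intro!: eq_vecI)
next
  case False
  have fin: "finite S"
    by (simp add: S)
  have x: "x i \<in> carrier_vec (dim_col (K i))" if "i \<in> S" for i
    using assms(1,3)[of i] that by (auto simp: S agents_of_row_def)
  let ?h = "\<lambda>i. row (K i) r \<bullet> x i + c i $ r"
  let ?t = "finsum_vec TYPE(real) R (\<lambda>i. K i *\<^sub>v x i + c i) {1..N} $ r"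
  have t: "?t = sum ?h S"
    unfolding S by (rule coupled_constraint_row[OF assms(1-4)])
  \<comment> \<open>The target for (I - P)y is what each agent lacks to reach the average; these
    deficits sum to zero and so lie in the range of I - P.\<close>
  have "(\<Sum>i\<in>S. ?t / card S - ?h i) = 0"
    using fin False unfolding t by (simp add: sum_subtractf)
  then obtain Y where Y: "\<And>i. i \<in> S \<Longrightarrow> Y i - (\<Sum>j\<in>S. w i j * Y j) = ?t / card S - ?h i"
    using consensus_weights_range[OF H(2) _ H(3)[OF False], unfolded H(1), OF fin] by blast
  show thesis
  proof (rule that)
    show "local_constraint_lhs S K c r w x (vec (card S) (\<lambda>s. Y (sorted_list_of_set S ! s)))
        = vec (card S) (\<lambda>_. ?t / card S)"
      using Y bij_betwE[OF bij_betw_nth_sorted_list_of_set[OF fin]]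
      by (subst local_constraint_lhs_eq[OF fin x]) (auto simp: Let_def intro!: eq_vecI)
  qed simp
qed

section \<open>Equivalence of the coupled and the decoupled problem\<close>

theorem proposition1:
  fixes N M Q :: nat
    and d :: "nat \<Rightarrow> nat"
    and f :: "nat \<Rightarrow> real vec \<Rightarrow> real"
    and A E :: "nat \<Rightarrow> real mat"
    and b g :: "nat \<Rightarrow> real vec"
    and G :: "nat pair_pre_digraph"
    and p :: "nat \<Rightarrow> nat \<Rightarrow> nat \<Rightarrow> real"
  assumes A: "\<And>i. i \<in> {1..N} \<Longrightarrow> A i \<in> carrier_mat M (d i)"
    and b: "\<And>i. i \<in> {1..N} \<Longrightarrow> b i \<in> carrier_vec M"
    and E: "\<And>i. i \<in> {1..N} \<Longrightarrow> E i \<in> carrier_mat Q (d i)"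
    and g: "\<And>i. i \<in> {1..N} \<Longrightarrow> g i \<in> carrier_vec Q"
    and G: "pair_pseudo_graph G" "pverts G = {1..N}"
    and induced_undirected:
      "\<And>l. l < M + Q \<Longrightarrow> symmetric (induced_comm_graph G N M A b E g l)"
    and induced_connected:
      "\<And>l. l < M + Q \<Longrightarrow> affected_agents N M A b E g l \<noteq> {} \<Longrightarrow>
         Digraph_Component.connected (induced_comm_graph G N M A b E g l)"
    and p: "\<And>l. l < M + Q \<Longrightarrow> consensus_weights (induced_comm_graph G N M A b E g l) (p l)"
  shows "(\<forall>x y. objective (decoupled_problem N M Q d f A b E g p) (x, y)
              = objective (coupled_problem N M Q d f A b E g) x)
       \<and> (\<forall>x y. (x, y) \<in> feasible_set (decoupled_problem N M Q d f A b E g p) \<longrightarrow>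
              x \<in> feasible_set (coupled_problem N M Q d f A b E g))
       \<and> (\<forall>x. x \<in> feasible_set (coupled_problem N M Q d f A b E g) \<longrightarrow>
              (\<exists>y. (x, y) \<in> feasible_set (decoupled_problem N M Q d f A b E g p)))"
proof (intro conjI allI impI)
  let ?S = "affected_agents N M A b E g"
  let ?H = "induced_comm_graph G N M A b E g"
  let ?a = "\<lambda>x. finsum_vec TYPE(real) M (\<lambda>i. A i *\<^sub>v x i + b i) {1..N}"
  let ?e = "\<lambda>x. finsum_vec TYPE(real) Q (\<lambda>i. E i *\<^sub>v x i + g i) {1..N}"
  have verts: "verts (?H l) = ?S l" for l
    by (simp add: induced_comm_graph_def)
  have SA: "?S m = agents_of_row N A b m" if "m < M" for m
    using that by (simp add: affected_agents_def)
  have SE: "?S (M + q) = agents_of_row N E g q" for q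
    by (simp add: affected_agents_def)
  have fin: "finite (?S l)" for l
    by (simp add: affected_agents_def)

  show "objective (decoupled_problem N M Q d f A b E g p) (x, y)
      = objective (coupled_problem N M Q d f A b E g) x" for x y
    by (simp add: decoupled_problem_def coupled_problem_def)

  have dims: "?a x \<in> carrier_vec M" "?e x \<in> carrier_vec Q"
    if "\<And>i. i \<in> {1..N} \<Longrightarrow> x i \<in> carrier_vec (d i)" for x
    using A b E g that
    by (fastforce intro!: finsum_vec_closed add_carrier_vec mult_mat_vec_carrier)+

  show "x \<in> feasible_set (coupled_problem N M Q d f A b E g)"
    if feas: "(x, y) \<in> feasible_set (decoupled_problem N M Q d f A b E g p)" for x y
  proof -
    have x: "\<And>i. i \<in> {1..N} \<Longrightarrow> x i \<in> carrier_vec (d i)"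
      and y: "\<And>l. l < M + Q \<Longrightarrow> y l \<in> carrier_vec (card (?S l))"
      and ineq: "\<And>m. m < M \<Longrightarrow>
        local_constraint_lhs (?S m) A b m (p m) x (y m) \<le> 0\<^sub>v (card (?S m))"
      and eq: "\<And>q. q < Q \<Longrightarrow>
        local_constraint_lhs (?S (M + q)) E g q (p (M + q)) x (y (M + q)) = 0\<^sub>v (card (?S (M + q)))"
      using feas by (auto simp: decoupled_problem_def Let_def)
    have "?a x $ m \<le> 0" if m: "m < M" for m
    proof -
      \<comment> \<open>A sum of nonpositive entries is nonpositive, and this sum is the coupled row
        \<open>m\<close>.\<close>
      have "(\<Sum>s<card (?S m). local_constraint_lhs (?S m) A b m (p m) x (y m) $ s) \<le> 0"
        using ineq[OF m] by (auto simp: less_eq_vec_def intro!: sum_nonpos)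
      then show ?thesis
        using sum_local_constraint_lhs[OF A b x m SA[OF m] verts p y] m by simp
    qed
    moreover have "?e x $ q = 0" if q: "q < Q" for q
      using sum_local_constraint_lhs[OF E g x q SE verts p y] eq[OF q] q by simp
    ultimately show ?thesis
      using x dims[OF x] by (auto simp: coupled_problem_def less_eq_vec_def intro!: eq_vecI)
  qed

  show "\<exists>y. (x, y) \<in> feasible_set (decoupled_problem N M Q d f A b E g p)"
    if feas: "x \<in> feasible_set (coupled_problem N M Q d f A b E g)" for x
  proof -
    have x: "\<And>i. i \<in> {1..N} \<Longrightarrow> x i \<in> carrier_vec (d i)"
      and ineq: "?a x \<le> 0\<^sub>v M" and eq: "?e x = 0\<^sub>v Q"
      using feas by (auto simp: coupled_problem_def)
    \<comment> \<open>One predicate for both kinds of constraint lets a single choice over all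
      \<open>l < M + Q\<close> produce the whole family \<open>y\<close>; \<open>l - M\<close>
      recovers the row of \<open>E\<close>.\<close>
    let ?good = "\<lambda>l y. y \<in> carrier_vec (card (?S l)) \<and>
      (if l < M then local_constraint_lhs (?S l) A b l (p l) x y \<le> 0\<^sub>v (card (?S l))
       else local_constraint_lhs (?S l) E g (l - M) (p l) x y = 0\<^sub>v (card (?S l)))"
    have "\<exists>y. ?good l y" if l: "l < M + Q" for l
    proof (cases "l < M")
      case True
      obtain y where "y \<in> carrier_vec (card (?S l))"
        "local_constraint_lhs (?S l) A b l (p l) x y = vec (card (?S l)) (\<lambda>_. ?a x $ l / card (?S l))"
        using equalize_local_constraint_lhs[OF A b x True SA[OF True] verts p[OF l] induced_connected[OF l]]
        by blast
      moreover have "?a x $ l \<le> 0"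
        using ineq True by (auto simp: less_eq_vec_def)
      ultimately show ?thesis
        using True by (auto simp: less_eq_vec_def intro!: exI[of _ y] divide_nonpos_nonneg)
    next
      case False
      then obtain q where q: "l = M + q" "q < Q"
        using l by (metis add_less_cancel_left le_iff_add not_less)
      obtain y where "y \<in> carrier_vec (card (?S l))"
        "local_constraint_lhs (?S l) E g q (p l) x y = vec (card (?S l)) (\<lambda>_. ?e x $ q / card (?S l))"
        using equalize_local_constraint_lhs[OF E g x q(2) SE[of q] verts] p[OF l] induced_connected[OF l]
        unfolding q(1) by blast
      then show ?thesis
        using q eq by (auto intro!: exI[of _ y] eq_vecI)
    qed
    then obtain y where y: "\<And>l. l < M + Q \<Longrightarrow> ?good l (y l)"
      by metis
    have "(x, y) \<in> feasible_set (decoupled_problem N M Q d f A b E g p)"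
      \<comment> \<open>The instance at \<open>M + q\<close> selects the equality branch of
        \<open>?good\<close>, where \<open>M + q - M\<close> is \<open>q\<close>.\<close>
      using x y y[of "M + _"] by (auto simp: decoupled_problem_def Let_def)
    then show ?thesis by blast
  qed
qed

end
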